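(* Let $\mathcal{Q},\mathcal{U},\mathcal{Y}$ be nonzero finite dimensional real Hilbert spaces with $\dim\mathcal{Q}=\dim\mathcal{U}=n_q$ and $\dim\mathcal{Y}=n_{\mathrm{obs}}$. Let $A:\mathcal{U}\to\mathcal{Q}$ be an invertible linear map, $B:\mathcal{U}\to\mathcal{Y}$ a linear map, $R:\mathcal{Q}\to\mathcal{Q}$ an invertible linear map, $T:=-I:\mathcal{Q}\to\mathcal{Q}$ (source inversion problem), and $\alpha>0$, $\rho>0$. Let $J:=-BA^{-1}T=BA^{-1}$, and suppose that $R$ is a spectral filtering regularization operator for the inverse problem with parameter-to-observable map $J$ (see context), with associated singular values $d_k$ of $J$ and $r_k$ of $R$, $k=1,\dots,n_q$. Suppose there are constants $\mu,\nu$ such that for all $k=1,\dots,n_q$ $$0<\mu\le d_k^2+\alpha r_k^2\qquad\text{and}\qquad d_kr_k\le\nu<\infty .$$ Let $Q_R$ and $Q_J$ be as defined in the context. Then, with $$\delta=\frac12\left(1+\frac{\alpha}{\rho^2}\nu^2\right)^{-1},\qquad \beta=\left(1+\frac1\rho\,\mu\right)^{-1/2},$$ one has $$0<\delta\le\tfrac12\lambda_{\min}(Q_R+Q_J)\qquad\text{and}\qquad\lambda_{\max}(Q_RQ_J)^{1/2}\le\beta<1 .$$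
   Context: Stars denote Hilbert space adjoints and $I$ the identity; $\lambda_{\min},\lambda_{\max}$ denote smallest and largest eigenvalues of operators with real eigenvalues. Spectral filtering regularization: $R$ is a spectral filtering regularization operator for a linear inverse problem with parameter-to-observable map $J:\mathcal{Q}\to\mathcal{Y}$ if $R$ and $J$ share a common basis of right singular vectors, i.e. there exist unitary (inner product preserving, bijective) operators $U:\mathbb{R}^{n_{\mathrm{obs}}}\to\mathcal{Y}$, $V:\mathbb{R}^{n_q}\to\mathcal{Q}$, $\Phi:\mathbb{R}^{n_q}\to\mathcal{Q}$ and nonnegative diagonal operators $\Sigma_J=\operatorname{diag}(d_k):\mathbb{R}^{n_q}\to\mathbb{R}^{n_{\mathrm{obs}}}$ and $\Sigma_R=\operatorname{diag}(r_k):\mathbb{R}^{n_q}\to\mathbb{R}^{n_q}$ (a rectangular diagonal operator has $k$th diagonal entry as indicated and zeros elsewhere) such that $$J=U\Sigma_J\Phi^*,\qquad R=V\Sigma_R\Phi^* .$$ The $d_k$ are ordered so that $d_k\ge d_{k+1}$ (this fixes a, possibly non-monotone, order for the $r_k$); if $n_{\mathrm{obs}}<n_q$, set $d_k:=0$ for $k=n_{\mathrm{obs}}+1,\dots,n_q$. Damped projectors: $$Q_R:=T\left(\tfrac{\alpha}{\rho}R^*R+T^*T\right)^{-1}T^*,\qquad Q_J:=A\left(\tfrac1\rho B^*B+A^*A\right)^{-1}A^* .$$ Both are self-adjoint positive semidefinite operators on $\mathcal{Q}$, so $Q_RQ_J$ has real nonnegative eigenvalues. *)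

theory Defs
  imports "HOL-Analysis.Analysis"
begin

text \<open>A real number is an eigenvalue only if it has an eigenvector in the (real) space itself.
  \<open>lambda_min\<close> and \<open>lambda_max\<close> are meant for operators on a Euclidean space that have
  at least one real eigenvalue; then the set below is finite and nonempty.\<close>

definition eigenvalues :: "('a::euclidean_space \<Rightarrow> 'a) \<Rightarrow> real set" where
  "eigenvalues F = {l. \<exists>v. v \<noteq> 0 \<and> F v = l *\<^sub>R v}"

definition lambda_min :: "('a::euclidean_space \<Rightarrow> 'a) \<Rightarrow> real" where
  "lambda_min F = Min (eigenvalues F)"

definition lambda_max :: "('a::euclidean_space \<Rightarrow> 'a) \<Rightarrow> real" where
  "lambda_max F = Max (eigenvalues F)"

definition unitary :: "('a::real_inner \<Rightarrow> 'b::real_inner) \<Rightarrow> bool" where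
  "unitary U \<longleftrightarrow> linear U \<and> (\<forall>x y. U x \<bullet> U y = x \<bullet> y) \<and> bij U"

text \<open>The index type of \<open>real ^ 'n\<close> carries no order, so its coordinates are numbered
  \<open>1, \<dots>, CARD('n)\<close> by the library enumeration \<open>to_nat_on\<close>, which maps a finite set
  bijectively onto an initial segment of the naturals starting at 0.\<close>

definition pos :: "'n::finite \<Rightarrow> nat" where
  "pos i = Suc (to_nat_on (UNIV :: 'n set) i)"

lemma bij_betw_pos: "bij_betw (pos :: 'n::finite \<Rightarrow> nat) UNIV {1..CARD('n)}"
proof -
  have "bij_betw (to_nat_on (UNIV :: 'n set)) UNIV {..<CARD('n)}"
    by (rule to_nat_on_finite) simp
  moreover have "bij_betw Suc {..<CARD('n)} {1..CARD('n)}"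
    by (simp add: bij_betw_def image_Suc_lessThan)
  ultimately have "bij_betw (Suc \<circ> to_nat_on (UNIV :: 'n set)) UNIV {1..CARD('n)}"
    by (rule bij_betw_trans)
  then show ?thesis
    by (simp add: pos_def[abs_def] comp_def)
qed

text \<open>Rectangular diagonal matrix with \<open>k\<close>th diagonal entry \<open>d k\<close>, where
  \<open>1 \<le> k \<le> min CARD('m) CARD('n)\<close>; the values of \<open>d\<close> elsewhere do not matter.\<close>

definition diag_mat :: "(nat \<Rightarrow> real) \<Rightarrow> real ^ 'n ^ 'm" where
  "diag_mat d = (\<chi> i j. if pos i = pos j then d (pos i) else 0)"

text \<open>\<open>R\<close> is a spectral filtering regularization operator for the parameter-to-observable map
  \<open>J\<close>, as witnessed by the unitary operators \<open>U\<close>, \<open>V\<close>, \<open>\<Phi>\<close> and the singular values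
  \<open>d k\<close> of \<open>J\<close> and \<open>r k\<close> of \<open>R\<close> (\<open>1 \<le> k \<le> CARD('n)\<close>).
  The operators are arguments because a definition cannot quantify over
  the index types \<open>'n\<close> and \<open>'m\<close>.\<close>

definition spectral_filtering ::
  "(real ^ 'm \<Rightarrow> 'y::euclidean_space) \<Rightarrow> (real ^ 'n \<Rightarrow> 'q::euclidean_space) \<Rightarrow> (real ^ 'n \<Rightarrow> 'q) \<Rightarrow>
   (nat \<Rightarrow> real) \<Rightarrow> (nat \<Rightarrow> real) \<Rightarrow> ('q \<Rightarrow> 'y) \<Rightarrow> ('q \<Rightarrow> 'q) \<Rightarrow> bool" where
  "spectral_filtering U V \<Phi> d r J R \<longleftrightarrow>
     unitary U \<and> unitary V \<and> unitary \<Phi> \<and>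
     (\<forall>k\<in>{1..CARD('n)}. 0 \<le> d k \<and> 0 \<le> r k) \<and>
     (\<forall>k\<in>{1..<CARD('n)}. d (Suc k) \<le> d k) \<and>
     (\<forall>k\<in>{CARD('m)<..CARD('n)}. d k = 0) \<and>
     J = (\<lambda>x. U ((diag_mat d :: real ^ 'n ^ 'm) *v adjoint \<Phi> x)) \<and>
     R = (\<lambda>x. V ((diag_mat r :: real ^ 'n ^ 'n) *v adjoint \<Phi> x))"

text \<open>The damped projectors. The inverses are those of the maps in parentheses, which are bijective
  when \<open>\<alpha>\<close> and \<open>\<rho>\<close> are positive and \<open>T\<close> and \<open>A\<close> are injective.\<close>

definition Q_R :: "real \<Rightarrow> real \<Rightarrow> ('q::euclidean_space \<Rightarrow> 'q) \<Rightarrow> ('q \<Rightarrow> 'q) \<Rightarrow> 'q \<Rightarrow> 'q" where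
  "Q_R \<alpha> \<rho> R T =
     T \<circ> inv (\<lambda>x. (\<alpha> / \<rho>) *\<^sub>R adjoint R (R x) + adjoint T (T x)) \<circ> adjoint T"

definition Q_J :: "real \<Rightarrow> ('u::euclidean_space \<Rightarrow> 'q::euclidean_space) \<Rightarrow>
    ('u \<Rightarrow> 'y::euclidean_space) \<Rightarrow> 'q \<Rightarrow> 'q" where
  "Q_J \<rho> A B =
     A \<circ> inv (\<lambda>u. (1 / \<rho>) *\<^sub>R adjoint B (B u) + adjoint A (A u)) \<circ> adjoint A"

end

theory Submission
  imports Defs
begin

text \<open>With \<open>J = B A\<inverse>\<close> and \<open>T = -I\<close>, the damped projectors are \<open>Q_R = (I + \<alpha>/\<rho> R\<^sup>*R)\<inverse>\<close> and
  \<open>Q_J = (I + 1/\<rho> J\<^sup>*J)\<inverse>\<close>. The unitary \<open>\<Phi>\<close> diagonalizes both, with eigenvalues \<open>1/(1 + a)\<close> and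
  \<open>1/(1 + b)\<close>, where \<open>a = \<alpha> r\<^sup>2/\<rho>\<close> and \<open>b = d\<^sup>2/\<rho>\<close>. For \<open>a, b \<ge> 0\<close> one has
  \<open>1/(1 + a) + 1/(1 + b) \<ge> 1/(1 + a b)\<close> and \<open>(1 + a)(1 + b) \<ge> 1 + a + b\<close>, while
  \<open>a b \<le> \<alpha> \<nu>\<^sup>2/\<rho>\<^sup>2\<close> and \<open>a + b \<ge> \<mu>/\<rho>\<close>.\<close>

section \<open>Rectangular diagonal matrices and their Gram matrices\<close>

lemma pos_inj: "pos i = pos j \<Longrightarrow> i = j"
  using bij_betw_pos by (auto simp: bij_betw_def dest: injD)

lemma pos_le_CARD: "1 \<le> pos (i :: 'n::finite)" "pos i \<le> CARD('n)"
  using bij_betwE[OF bij_betw_pos] by auto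

lemma exists_pos: "1 \<le> k \<Longrightarrow> k \<le> CARD('n) \<Longrightarrow> \<exists>i :: 'n::finite. pos i = k"
proof -
  assume "1 \<le> k" "k \<le> CARD('n)"
  then have "k \<in> range (pos :: 'n \<Rightarrow> nat)"
    using bij_betw_pos[where 'n = 'n] by (simp add: bij_betw_def)
  then show ?thesis by auto
qed

lemma transpose_diag_mat: "transpose (diag_mat d :: real ^ 'n::finite ^ 'm::finite) = diag_mat d"
  by (simp add: transpose_def diag_mat_def vec_eq_iff)

text \<open>Rows and columns carry different index types and are matched only through
  \<open>pos\<close>. As \<open>pos\<close> is injective, one column at most meets row
  \<open>j\<close>, and the sum collapses to a single term.\<close>

lemma diag_mat_mult_nth:
  fixes x :: "real ^ 'n" and j :: "'m::finite"
  assumes "pos i = pos j"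
  shows "(diag_mat d *v x) $ j = d (pos i) * x $ i"
proof -
  have "pos j = pos k \<longleftrightarrow> k = i" for k
    using assms pos_inj by metis
  then show ?thesis
    using assms by (simp add: matrix_vector_mult_def diag_mat_def if_distrib[of "\<lambda>c. c * _"] cong: if_cong)
qed

lemma diag_mat_mult_nth_0:
  fixes x :: "real ^ 'n" and j :: "'m::finite"
  assumes "\<And>i :: 'n. pos i \<noteq> pos j"
  shows "(diag_mat d *v x) $ j = 0"
  using assms[symmetric] by (simp add: matrix_vector_mult_def diag_mat_def)

text \<open>A column with a row at the same position contributes its entry twice, hence the square.
  A column positioned beyond \<open>CARD('m)\<close> is zero, and the zero padding of
  \<open>d\<close> makes the right-hand side vanish there too.\<close>

lemma diag_mat_transpose_mult:
  fixes x :: "real ^ 'n"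
  assumes "\<And>k. k \<in> {CARD('m)<..CARD('n)} \<Longrightarrow> d k = 0"
  shows "transpose (diag_mat d :: real ^ 'n ^ 'm::finite) *v (diag_mat d *v x)
    = (\<chi> i. (d (pos i))\<^sup>2 * x $ i)"
  unfolding transpose_diag_mat
proof (rule vec_eq_iff[THEN iffD2], rule allI)
  fix i :: 'n
  show "(diag_mat d *v ((diag_mat d :: real ^ 'n ^ 'm) *v x)) $ i
    = (\<chi> i. (d (pos i))\<^sup>2 * x $ i) $ i"
  proof (cases "pos i \<le> CARD('m)")
    case True
    then obtain j :: 'm where j: "pos j = pos i"
      using exists_pos pos_le_CARD(1) by metis
    show ?thesis
      by (simp add: diag_mat_mult_nth[OF j] diag_mat_mult_nth[OF j[symmetric]] j power2_eq_square)
  next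
    case False
    then have "d (pos i) = 0"
      using assms pos_le_CARD(2)[of i] by simp
    moreover have "pos j \<noteq> pos i" for j :: 'm
      using False pos_le_CARD(2)[of j] by auto
    ultimately show ?thesis
      by (simp add: diag_mat_mult_nth_0)
  qed
qed

section \<open>Adjoints and spectra in unitary coordinates\<close>

lemma linear_inv_bij:
  assumes "linear f" "bij f"
  shows "linear (inv f)"
proof (rule linearI)
  have f: "inv f (f x) = x" "f (inv f y) = y" for x y
    using \<open>bij f\<close> by (simp_all add: bij_is_inj bij_is_surj surj_f_inv_f)
  show "inv f (x + y) = inv f x + inv f y" for x y
    by (metis f linear_add[OF \<open>linear f\<close>])
  show "inv f (c *\<^sub>R x) = c *\<^sub>R inv f x" for c x
    by (metis f linear_cmul[OF \<open>linear f\<close>])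
qed

lemma adjoint_unitary:
  fixes W :: "'a::euclidean_space \<Rightarrow> 'b::euclidean_space"
  assumes "unitary W"
  shows "adjoint W (W x) = x"
proof (rule vector_eq_ldot[THEN iffD1], rule allI)
  fix z
  show "z \<bullet> adjoint W (W x) = z \<bullet> x"
    using assms adjoint_works[of W z "W x"] by (simp add: unitary_def)
qed

text \<open>On the range of \<open>\<Phi>\<close> the map \<open>K\<close> is \<open>W\<close> after
  the diagonal matrix, and \<open>W\<close> drops out of inner products. Testing against all
  \<open>\<Phi> z\<close>, which by surjectivity are all vectors, leaves only the Gram matrix of the
  diagonal.\<close>

lemma adjoint_apply_spectral:
  fixes W :: "real ^ 'm \<Rightarrow> 'y::euclidean_space" and \<Phi> :: "real ^ 'n \<Rightarrow> 'q::euclidean_space"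
  assumes "unitary W" "unitary \<Phi>"
    and "\<And>k. k \<in> {CARD('m)<..CARD('n)} \<Longrightarrow> d k = 0"
    and K: "K = (\<lambda>x. W ((diag_mat d :: real ^ 'n ^ 'm) *v adjoint \<Phi> x))" and "linear K"
  shows "adjoint K (K (\<Phi> x)) = \<Phi> (\<chi> i. (d (pos i))\<^sup>2 * x $ i)"
proof (rule vector_eq_ldot[THEN iffD1], rule allI)
  let ?D = "diag_mat d :: real ^ 'n ^ 'm"
  fix v
  obtain z where v: "v = \<Phi> z"
    using \<open>unitary \<Phi>\<close> by (metis unitary_def bij_pointE)
  have K\<Phi>: "K (\<Phi> y) = W (?D *v y)" for y
    using adjoint_unitary[OF \<open>unitary \<Phi>\<close>] by (simp add: K)
  have D: "transpose ?D *v (?D *v x) = (\<chi> i. (d (pos i))\<^sup>2 * x $ i)"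
    by (rule diag_mat_transpose_mult) (rule assms(3))
  have "v \<bullet> adjoint K (K (\<Phi> x)) = K (\<Phi> z) \<bullet> K (\<Phi> x)"
    using adjoint_works[OF \<open>linear K\<close>] by (simp add: v inner_commute)
  also have "\<dots> = (?D *v z) \<bullet> (?D *v x)"
    using \<open>unitary W\<close> by (simp add: K\<Phi> unitary_def)
  also have "\<dots> = z \<bullet> (transpose ?D *v (?D *v x))"
    by (metis dot_lmul_matrix inner_commute vector_transpose_matrix transpose_transpose)
  also have "\<dots> = v \<bullet> \<Phi> (\<chi> i. (d (pos i))\<^sup>2 * x $ i)"
    using \<open>unitary \<Phi>\<close> by (simp add: D v unitary_def del: transpose_matrix_vector)
  finally show "v \<bullet> adjoint K (K (\<Phi> x)) = v \<bullet> \<Phi> (\<chi> i. (d (pos i))\<^sup>2 * x $ i)" .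
qed

text \<open>A nonzero coordinate of an eigenvector forces its eigenvalue to be the matching
  \<open>c i\<close>; conversely \<open>\<Phi>\<close> maps the coordinate axes to eigenvectors.
  This serves both the sum and the product of the damped projectors.\<close>

lemma eigenvalues_diagonal:
  fixes F :: "'q::euclidean_space \<Rightarrow> 'q" and \<Phi> :: "real ^ 'n \<Rightarrow> 'q"
  assumes "unitary \<Phi>" and F: "\<And>x. F (\<Phi> x) = \<Phi> (\<chi> i. c i * x $ i)"
  shows "eigenvalues F = range c"
proof -
  have lin: "linear \<Phi>" and inj: "\<Phi> x = \<Phi> y \<longleftrightarrow> x = y" and surj: "\<exists>x. v = \<Phi> x" for x y v
    using \<open>unitary \<Phi>\<close> by (auto simp: unitary_def bij_def inj_eq surj_def)
  have "l \<in> range c" if "F v = l *\<^sub>R v" "v \<noteq> 0" for l v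
  proof -
    obtain x where x: "v = \<Phi> x" using surj by blast
    have "x \<noteq> 0" using that x linear_0[OF lin] by auto
    then obtain i where "x $ i \<noteq> 0" by (auto simp: vec_eq_iff)
    moreover have "\<Phi> (\<chi> i. c i * x $ i) = \<Phi> (l *\<^sub>R x)"
      using that x F linear_cmul[OF lin] by simp
    ultimately show ?thesis by (auto simp: inj vec_eq_iff)
  qed
  moreover have "c i \<in> eigenvalues F" for i
  proof -
    have "(\<chi> k. c k * (axis i 1 :: real ^ 'n) $ k) = c i *\<^sub>R axis i 1"
      by (simp add: vec_eq_iff axis_def)
    then have "F (\<Phi> (axis i 1)) = c i *\<^sub>R \<Phi> (axis i 1)"
      using F linear_cmul[OF lin] by simp
    moreover have "\<Phi> (axis i 1) \<noteq> 0"
      using inj[of "axis i 1" 0] linear_0[OF lin] by (simp add: axis_eq_0_iff)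
    ultimately show ?thesis by (auto simp: eigenvalues_def)
  qed
  ultimately show ?thesis by (auto simp: eigenvalues_def)
qed

text \<open>Evaluates a damped projector from a guessed solution \<open>u\<close> of its normal
  equation. Pairing the regularized operator with \<open>x\<close> gives c |B x|^2 + |A x|^2, so a
  kernel vector satisfies A x = 0 and is zero. By injectivity \<open>inv\<close> must return
  \<open>u\<close>.\<close>

lemma damped_projector_eqI:
  fixes A :: "'u::euclidean_space \<Rightarrow> 'q::euclidean_space" and B :: "'u \<Rightarrow> 'y::euclidean_space"
  assumes "linear A" "inj A" "linear B" "0 \<le> c"
    and u: "c *\<^sub>R adjoint B (B u) + adjoint A (A u) = adjoint A y"
  shows "A (inv (\<lambda>x. c *\<^sub>R adjoint B (B x) + adjoint A (A x)) (adjoint A y)) = A u"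
proof -
  let ?G = "\<lambda>x. c *\<^sub>R adjoint B (B x) + adjoint A (A x)"
  have "linear ?G"
    using adjoint_linear[OF \<open>linear A\<close>] adjoint_linear[OF \<open>linear B\<close>] \<open>linear A\<close> \<open>linear B\<close>
    by (intro linearI) (simp_all add: linear_add linear_cmul scaleR_add_right)
  moreover have "x = 0" if "?G x = 0" for x
  proof -
    have "0 = x \<bullet> ?G x" using that by simp
    also have "\<dots> = c * (B x \<bullet> B x) + A x \<bullet> A x"
      by (simp add: inner_add_right adjoint_works[OF \<open>linear A\<close>] adjoint_works[OF \<open>linear B\<close>])
    finally have "c * (B x \<bullet> B x) + A x \<bullet> A x = 0" ..
    moreover have "0 \<le> c * (B x \<bullet> B x)"
      using \<open>0 \<le> c\<close> by simp
    ultimately have "A x \<bullet> A x = 0"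
      using inner_ge_zero[of "A x"] by linarith
    then show ?thesis
      using linear_injective_0[OF \<open>linear A\<close>] \<open>inj A\<close> by simp
  qed
  ultimately have "inj ?G"
    using linear_injective_0 by blast
  then have "inv ?G (?G u) = u" by (rule inv_f_f)
  then show ?thesis by (simp add: u)
qed

theorem theorem5p2:
  fixes A :: "'u::euclidean_space \<Rightarrow> 'q::euclidean_space"
    and B :: "'u \<Rightarrow> 'y::euclidean_space"
    and R T :: "'q \<Rightarrow> 'q"
    and J :: "'q \<Rightarrow> 'y"
    and U :: "real ^ 'm \<Rightarrow> 'y"
    and V \<Phi> :: "real ^ 'n \<Rightarrow> 'q"
    and d r :: "nat \<Rightarrow> real"
    and \<alpha> \<rho> \<mu> \<nu> \<delta> \<beta> :: real
  assumes "DIM('q) = CARD('n)" and "DIM('u) = CARD('n)" and "DIM('y) = CARD('m)"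
    and "linear A" and "bij A"
    and "linear B"
    and "linear R" and "bij R"
    and "T = (\<lambda>x. - x)"
    and "0 < \<alpha>" and "0 < \<rho>"
    and "J = (\<lambda>x. - B (inv A (T x)))"
    and "spectral_filtering U V \<Phi> d r J R"
    and "0 < \<mu>"
    and "\<And>k. k \<in> {1..CARD('n)} \<Longrightarrow> \<mu> \<le> (d k)\<^sup>2 + \<alpha> * (r k)\<^sup>2"
    and "\<And>k. k \<in> {1..CARD('n)} \<Longrightarrow> d k * r k \<le> \<nu>"
    and "\<delta> = 1 / 2 * inverse (1 + \<alpha> / \<rho>\<^sup>2 * \<nu>\<^sup>2)"
    and "\<beta> = (1 + 1 / \<rho> * \<mu>) powr (- 1 / 2)"
  shows "0 < \<delta> \<and> \<delta> \<le> 1 / 2 * lambda_min (\<lambda>x. Q_R \<alpha> \<rho> R T x + Q_J \<rho> A B x) \<and>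
    sqrt (lambda_max (Q_R \<alpha> \<rho> R T \<circ> Q_J \<rho> A B)) \<le> \<beta> \<and> \<beta> < 1"
proof -

  \<comment> \<open>The maps \<open>J\<close>, \<open>B\<close> and \<open>T\<close> and their
    adjoints\<close>
  note sf = \<open>spectral_filtering U V \<Phi> d r J R\<close>[unfolded spectral_filtering_def]
  have "unitary U" "unitary V" "unitary \<Phi>"
    using sf by blast+
  have pos_in: "pos i \<in> {1..CARD('n)}" for i :: 'n
    using pos_le_CARD[of i] by simp
  have dr: "0 \<le> d (pos i)" "0 \<le> r (pos i)" for i :: 'n
    using sf pos_in[of i] by blast+
  have "linear \<Phi>"
    using \<open>unitary \<Phi>\<close> by (simp add: unitary_def)
  have "linear (inv A)"
    using assms(4,5) by (rule linear_inv_bij)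
  \<comment> \<open>The minus sign in \<open>J\<close> cancels against the one in
    \<open>T\<close>.\<close>
  have J: "J = (\<lambda>x. B (inv A x))"
    using linear_neg[OF \<open>linear (inv A)\<close>] linear_neg[OF \<open>linear B\<close>] assms(9,12) by simp
  have "linear J"
    unfolding J using \<open>linear (inv A)\<close> \<open>linear B\<close> by (rule linear_compose[unfolded comp_def])
  \<comment> \<open>Through this factorization the operator inverted in \<open>Q_J\<close> becomes I
    + 1/\<rho> \<open>adjoint J \<circ> J\<close>, with \<open>A\<close> applied first and
    \<open>adjoint A\<close> last, so that \<open>A\<close> cancels from \<open>Q_J\<close>.\<close>
  have B: "B = J \<circ> A"
    using \<open>bij A\<close> by (simp add: J fun_eq_iff bij_is_inj)
  have adjB: "adjoint B y = adjoint A (adjoint J y)" for y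
  proof (rule vector_eq_ldot[THEN iffD1], rule allI)
    fix z
    show "z \<bullet> adjoint B y = z \<bullet> adjoint A (adjoint J y)"
      using fun_cong[OF B, of z]
      by (simp add: adjoint_works[OF \<open>linear A\<close>] adjoint_works[OF \<open>linear B\<close>] adjoint_works[OF \<open>linear J\<close>])
  qed
  have "linear T"
    using assms(9) by (simp add: linear_iff)
  have T: "adjoint T y = - y" for y
  proof (rule vector_eq_ldot[THEN iffD1], rule allI)
    fix z
    show "z \<bullet> adjoint T y = z \<bullet> (- y)"
      using adjoint_works[OF \<open>linear T\<close>, of z y] assms(9) by simp
  qed

  \<comment> \<open>Diagonalization of the damped projectors\<close>
  define a where "a i = \<alpha> / \<rho> * (r (pos i))\<^sup>2" for i :: 'n
  define b where "b i = 1 / \<rho> * (d (pos i))\<^sup>2" for i :: 'n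
  have a0: "0 \<le> a i" and b0: "0 \<le> b i" for i
    using assms(10,11) by (simp_all add: a_def b_def)
  have RR: "adjoint R (R (\<Phi> x)) = \<Phi> (\<chi> i. (r (pos i))\<^sup>2 * x $ i)" for x
  proof (rule adjoint_apply_spectral[OF \<open>unitary V\<close> \<open>unitary \<Phi>\<close> _ _ \<open>linear R\<close>])
    \<comment> \<open>\<open>R\<close> is square, so this index range is empty; for \<open>J\<close>
      the analogous condition is the zero padding of \<open>d\<close>.\<close>
    show "r k = 0" if "k \<in> {CARD('n)<..CARD('n)}" for k
      using that by simp
    show "R = (\<lambda>x. V ((diag_mat r :: real ^ 'n ^ 'n) *v adjoint \<Phi> x))"
      using sf by (elim conjE)
  qed
  have JJ: "adjoint J (J (\<Phi> x)) = \<Phi> (\<chi> i. (d (pos i))\<^sup>2 * x $ i)" for x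
  proof (rule adjoint_apply_spectral[OF \<open>unitary U\<close> \<open>unitary \<Phi>\<close> _ _ \<open>linear J\<close>])
    show "d k = 0" if "k \<in> {CARD('m)<..CARD('n)}" for k
      using sf that by blast
    show "J = (\<lambda>x. U ((diag_mat d :: real ^ 'n ^ 'm) *v adjoint \<Phi> x))"
      using sf by (elim conjE)
  qed
  have QR: "Q_R \<alpha> \<rho> R T (\<Phi> x) = \<Phi> (\<chi> i. inverse (1 + a i) * x $ i)" for x
  proof -
    let ?z = "\<chi> i. inverse (1 + a i) * x $ i"
    have "(\<alpha> / \<rho>) *\<^sub>R (\<chi> i. (r (pos i))\<^sup>2 * ?z $ i) + ?z = x"
    proof (rule vec_eq_iff[THEN iffD2], rule allI)
      fix i
      have "a i * inverse (1 + a i) * x $ i + inverse (1 + a i) * x $ i = x $ i"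
        using a0[of i] by (simp add: field_simps add_nonneg_eq_0_iff)
      then show "((\<alpha> / \<rho>) *\<^sub>R (\<chi> i. (r (pos i))\<^sup>2 * ?z $ i) + ?z) $ i = x $ i"
        by (simp add: a_def algebra_simps)
    qed
    then have "(\<alpha> / \<rho>) *\<^sub>R adjoint R (R (\<Phi> ?z)) + \<Phi> ?z = \<Phi> x"
      by (simp only: RR linear_add[OF \<open>linear \<Phi>\<close>, symmetric] linear_cmul[OF \<open>linear \<Phi>\<close>, symmetric])
    \<comment> \<open>The normal equation has right-hand side \<open>adjoint T (\<Phi> x)\<close>,
      which is \<open>- \<Phi> x\<close>, so its solution is \<open>- \<Phi> ?z\<close>; the outer
      \<open>T\<close> restores the sign.\<close>
    then have "- ((\<alpha> / \<rho>) *\<^sub>R adjoint R (R (\<Phi> ?z))) + - \<Phi> ?z = - \<Phi> x"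
      by (simp only: minus_add_distrib[symmetric])
    then have "(\<alpha> / \<rho>) *\<^sub>R adjoint R (R (- \<Phi> ?z)) + adjoint T (T (- \<Phi> ?z)) = adjoint T (\<Phi> x)"
      unfolding T linear_neg[OF \<open>linear R\<close>] linear_neg[OF adjoint_linear[OF \<open>linear R\<close>]]
      by (simp only: assms(9) scaleR_minus_right minus_minus)
    then have "T (inv (\<lambda>x. (\<alpha> / \<rho>) *\<^sub>R adjoint R (R x) + adjoint T (T x)) (adjoint T (\<Phi> x)))
        = T (- \<Phi> ?z)"
      using assms(7,9,10,11) \<open>linear T\<close> by (intro damped_projector_eqI) (auto intro!: injI)
    then show ?thesis by (simp add: Q_R_def assms(9))
  qed
  have QJ: "Q_J \<rho> A B (\<Phi> x) = \<Phi> (\<chi> i. inverse (1 + b i) * x $ i)" for x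
  proof -
    let ?z = "\<chi> i. inverse (1 + b i) * x $ i"
    have A: "A (inv A v) = v" for v
      using \<open>bij A\<close> by (simp add: bij_is_surj surj_f_inv_f)
    have "(1 / \<rho>) *\<^sub>R (\<chi> i. (d (pos i))\<^sup>2 * ?z $ i) + ?z = x"
    proof (rule vec_eq_iff[THEN iffD2], rule allI)
      fix i
      have "b i * inverse (1 + b i) * x $ i + inverse (1 + b i) * x $ i = x $ i"
        using b0[of i] by (simp add: field_simps add_nonneg_eq_0_iff)
      then show "((1 / \<rho>) *\<^sub>R (\<chi> i. (d (pos i))\<^sup>2 * ?z $ i) + ?z) $ i = x $ i"
        by (simp add: b_def algebra_simps)
    qed
    then have "(1 / \<rho>) *\<^sub>R adjoint J (J (\<Phi> ?z)) + \<Phi> ?z = \<Phi> x"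
      by (simp only: JJ linear_add[OF \<open>linear \<Phi>\<close>, symmetric] linear_cmul[OF \<open>linear \<Phi>\<close>, symmetric])
    \<comment> \<open>Applying \<open>adjoint A\<close> turns the equation on the parameter space
      into the normal equation of \<open>Q_J\<close>, solved by
      \<open>inv A (\<Phi> ?z)\<close>.\<close>
    then have "adjoint A (\<Phi> x) = (1 / \<rho>) *\<^sub>R adjoint A (adjoint J (J (\<Phi> ?z))) + adjoint A (\<Phi> ?z)"
      by (simp only: linear_add[OF adjoint_linear[OF \<open>linear A\<close>], symmetric]
          linear_cmul[OF adjoint_linear[OF \<open>linear A\<close>], symmetric])
    then have "(1 / \<rho>) *\<^sub>R adjoint B (B (inv A (\<Phi> ?z))) + adjoint A (A (inv A (\<Phi> ?z)))
        = adjoint A (\<Phi> x)"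
      by (simp add: adjB A fun_cong[OF B])
    then have "A (inv (\<lambda>u. (1 / \<rho>) *\<^sub>R adjoint B (B u) + adjoint A (A u)) (adjoint A (\<Phi> x)))
        = A (inv A (\<Phi> ?z))"
      using assms(4,5,6,11) by (intro damped_projector_eqI) (auto simp: bij_is_inj)
    then show ?thesis by (simp add: Q_J_def A)
  qed

  \<comment> \<open>Spectra of the sum and of the product\<close>
  have "eigenvalues (\<lambda>x. Q_R \<alpha> \<rho> R T x + Q_J \<rho> A B x)
      = range (\<lambda>i. inverse (1 + a i) + inverse (1 + b i))"
  proof (rule eigenvalues_diagonal[OF \<open>unitary \<Phi>\<close>])
    show "Q_R \<alpha> \<rho> R T (\<Phi> x) + Q_J \<rho> A B (\<Phi> x)
        = \<Phi> (\<chi> i. (inverse (1 + a i) + inverse (1 + b i)) * x $ i)" for x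
      unfolding QR QJ linear_add[OF \<open>linear \<Phi>\<close>, symmetric]
      by (rule arg_cong[of _ _ \<Phi>]) (simp add: vec_eq_iff algebra_simps)
  qed
  \<comment> \<open>The spectrum is finite and nonempty, so the extremum is attained at some index,
    and a bound valid at every index suffices. The same holds for \<open>lambda_max\<close>
    below.\<close>
  then have "lambda_min (\<lambda>x. Q_R \<alpha> \<rho> R T x + Q_J \<rho> A B x)
      \<in> range (\<lambda>i. inverse (1 + a i) + inverse (1 + b i))"
    by (simp only: lambda_min_def) (rule Min_in, auto)
  then obtain i where min: "lambda_min (\<lambda>x. Q_R \<alpha> \<rho> R T x + Q_J \<rho> A B x)
      = inverse (1 + a i) + inverse (1 + b i)" by blast
  have "eigenvalues (Q_R \<alpha> \<rho> R T \<circ> Q_J \<rho> A B)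
      = range (\<lambda>i. inverse (1 + a i) * inverse (1 + b i))"
    by (rule eigenvalues_diagonal[OF \<open>unitary \<Phi>\<close>]) (simp add: QR QJ mult.assoc)
  then have "lambda_max (Q_R \<alpha> \<rho> R T \<circ> Q_J \<rho> A B)
      \<in> range (\<lambda>i. inverse (1 + a i) * inverse (1 + b i))"
    by (simp only: lambda_max_def) (rule Max_in, auto)
  then obtain j where max: "lambda_max (Q_R \<alpha> \<rho> R T \<circ> Q_J \<rho> A B)
      = inverse (1 + a j) * inverse (1 + b j)" by blast

  \<comment> \<open>Scalar bounds for \<open>\<delta>\<close> and \<open>\<beta>\<close>\<close>
  have "0 \<le> \<alpha> / \<rho>\<^sup>2 * \<nu>\<^sup>2"
    using assms(10) by simp
  then have "0 < \<delta>"
    by (simp add: assms(17) add_pos_nonneg)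
  moreover have "\<delta> \<le> 1 / 2 * (inverse (1 + a i) + inverse (1 + b i))"
  proof -
    \<comment> \<open>Squaring the bound by \<open>\<nu>\<close> is legitimate because the singular
      values are nonnegative.\<close>
    have "(d (pos i) * r (pos i))\<^sup>2 \<le> \<nu>\<^sup>2"
      using assms(16)[OF pos_in] dr by (intro power_mono) auto
    then have "\<alpha> / \<rho>\<^sup>2 * (d (pos i) * r (pos i))\<^sup>2 \<le> \<alpha> / \<rho>\<^sup>2 * \<nu>\<^sup>2"
      using assms(10) by (intro mult_left_mono) auto
    then have ab: "a i * b i \<le> \<alpha> / \<rho>\<^sup>2 * \<nu>\<^sup>2"
      by (simp add: a_def b_def power2_eq_square mult_ac)
    have "inverse (1 + \<alpha> / \<rho>\<^sup>2 * \<nu>\<^sup>2) \<le> inverse (1 + a i * b i)"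
      using ab a0[of i] b0[of i] by (intro le_imp_inverse_le) (auto intro: add_pos_nonneg)
    also have "\<dots> \<le> inverse (1 + a i) + inverse (1 + b i)"
    proof -
      \<comment> \<open>This is the difference of the two sides of the inequality below, which is
        the claim with denominators cleared.\<close>
      have "0 \<le> 1 + a i * b i + (a i + b i) * (a i * b i)"
        using a0[of i] b0[of i] by simp
      then have "(1 + a i) * (1 + b i) \<le> (2 + a i + b i) * (1 + a i * b i)"
        by (simp add: algebra_simps)
      moreover have "0 < 1 + a i" "0 < 1 + b i" "0 < 1 + a i * b i"
        using a0[of i] b0[of i] by (auto intro: add_pos_nonneg)
      ultimately show ?thesis
        by (simp add: divide_simps) (simp add: algebra_simps)
    qed
    finally show ?thesis by (simp add: assms(17))
  qed
  moreover have "0 < \<mu> / \<rho>"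
    using assms(11,14) by simp
  \<comment> \<open>With both sides written as square roots, only the radicands remain to be
    compared.\<close>
  have \<beta>: "\<beta> = sqrt (inverse (1 + \<mu> / \<rho>))"
    using \<open>0 < \<mu> / \<rho>\<close> by (simp add: assms(18) powr_minus powr_half_sqrt real_sqrt_inverse)
  have "sqrt (inverse (1 + a j) * inverse (1 + b j)) \<le> \<beta>"
  proof -
    have "\<mu> / \<rho> \<le> ((d (pos j))\<^sup>2 + \<alpha> * (r (pos j))\<^sup>2) / \<rho>"
      using assms(11) assms(15)[OF pos_in] by (intro divide_right_mono) auto
    also have "\<dots> = a j + b j"
      by (simp add: a_def b_def add_divide_distrib)
    finally have "1 + \<mu> / \<rho> \<le> (1 + a j) * (1 + b j)"
      using mult_nonneg_nonneg[OF a0[of j] b0[of j]] by (simp add: algebra_simps)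
    then have "inverse ((1 + a j) * (1 + b j)) \<le> inverse (1 + \<mu> / \<rho>)"
      using \<open>0 < \<mu> / \<rho>\<close> by (intro le_imp_inverse_le) auto
    then show ?thesis by (simp add: \<beta>)
  qed
  moreover have "\<beta> < 1"
    using \<open>0 < \<mu> / \<rho>\<close> by (simp add: \<beta> inverse_less_1_iff)
  ultimately show ?thesis
    unfolding min max by blast
qed

end
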